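(* For any integer $n\ge0$, $$\widetilde{Q}_n(\mathbf{x},t)=\sum_{\sigma\in\widetilde{\mathfrak{S}}_n}F_{\mathrm{DEX}(\sigma),n}(\mathbf{x})\,t^{\mathrm{exc}(\sigma)+1}.$$ Equivalently, for all $0\le j\le n$, $$\widetilde{Q}_{n,j}(\mathbf{x})=\sum_{\substack{\sigma\in\widetilde{\mathfrak{S}}_n\\ \mathrm{exc}(\sigma)=j-1}}F_{\mathrm{DEX}(\sigma),n}(\mathbf{x}).$$
   Context: Fundamental quasisymmetric functions: for $n\ge1$ and $S\subseteq[n-1]$, $F_{S,n}(\mathbf{x})=\sum x_{i_1}x_{i_2}\cdots x_{i_n}$, summed over $i_1\ge i_2\ge\cdots\ge i_n\ge1$ such that $j\in S\Rightarrow i_j>i_{j+1}$; $F_{\emptyset,0}=1$. $h_n(\mathbf x)$ is the complete homogeneous symmetric function ($h_0=1$). $\mathrm{DES}(w)=\{i\in[n-1]:w_i>w_{i+1}\}$ for a word $w=w_1\cdots w_n$ over a totally ordered alphabet. For $\sigma\in\mathfrak{S}_k$ let $\mathrm{EXC}(\sigma)=\{i:\sigma_i>i\}$, $\mathrm{exc}(\sigma)=|\mathrm{EXC}(\sigma)|$, let $\overline\sigma$ be obtained from the word $\sigma$ by replacing $\sigma_i$ with $\overline{\sigma_i}$ for $i\in\mathrm{EXC}(\sigma)$, and let $\mathrm{DEX}(\sigma)=\mathrm{DES}(\overline\sigma)$ with respect to the order $\overline1<\cdots<\overline k<1<\cdots<k$. The Eulerian quasisymmetric functions are given by $Q_k(\mathbf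 x,t)=\sum_{\sigma\in\mathfrak{S}_k}F_{\mathrm{DEX}(\sigma),k}(\mathbf x)t^{\mathrm{exc}(\sigma)}$ for $k\ge1$. Define $$\widetilde Q_n(\mathbf x,t)=h_n(\mathbf x)+t\sum_{k=1}^nh_{n-k}(\mathbf x)Q_k(\mathbf x,t),$$ and let $\widetilde Q_{n,j}(\mathbf x)$ be the coefficient of $t^j$ in $\widetilde Q_n(\mathbf x,t)$. A decorated permutation of $[n]$ is a permutation of a subset $S\subseteq[n]$; its one-line notation is the word $\sigma=\sigma_1\cdots\sigma_n$ with $\sigma_i$ the image of $i$ if $i\in S$ and $\sigma_i=0$ if $i\notin S$. $\widetilde{\mathfrak S}_n$ is the set of decorated permutations of $[n]$ and $\theta=0\cdots0$. For $\sigma\ne\theta$: $\mathrm{EXC}(\sigma)=\{i\in[n]:i<\sigma_i\}$, $\mathrm{exc}(\sigma)=|\mathrm{EXC}(\sigma)|$, $\overline\sigma$ is obtained from $\sigma$ by replacing $\sigma_i$ by $\overline{\sigma_i}$ for $i\in\mathrm{EXC}(\sigma)$, and $\mathrm{DEX}(\sigma)=\mathrm{DES}(\overline\sigma)$ with respect to the order $\overline1<\cdots<\overline n<0<1<\cdots<n$. Also $\mathrm{exc}(\theta)=-1$ and $\mathrm{DEX}(\theta)=\emptyset$. *)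

theory Defs
  imports
    "HOL-Library.FuncSet"
    "HOL-Library.Multiset"
    "HOL-Combinatorics.Permutations"
    "HOL-Computational_Algebra.Polynomial"
begin

section \<open>Formal power series in infinitely many commuting variables\<close>

text \<open>
  The variables \<open>x\<^sub>1, x\<^sub>2, \<dots>\<close> are indexed by natural numbers.  A monomial is the multiset of
  the indices of its factors, and a series is the family of its coefficients.  The index \<open>0\<close> is
  available in the type, but the series defined below do not involve \<open>x\<^sub>0\<close>.
\<close>

typedef 'a mseries = "UNIV :: (nat multiset \<Rightarrow> 'a) set"
  morphisms mcoeff Abs_mseries ..

setup_lifting type_definition_mseries

lemma mseries_eqI: "(\<And>M. mcoeff f M = mcoeff g M) \<Longrightarrow> f = g"
  by transfer auto

definition msplits :: "nat multiset \<Rightarrow> (nat multiset \<times> nat multiset) set" where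
  "msplits M = {(A, B). A + B = M}"

lemma mem_msplits [simp]: "(A, B) \<in> msplits M \<longleftrightarrow> A + B = M"
  by (simp add: msplits_def)

lemma finite_submultisets: "finite {A :: 'b multiset. A \<subseteq># M}"
proof (induction M)
  case empty
  show ?case by simp
next
  case (add x M)
  have "{A. A \<subseteq># add_mset x M} \<subseteq> {A. A \<subseteq># M} \<union> add_mset x ` {A. A \<subseteq># M}"
  proof
    fix A assume "A \<in> {A. A \<subseteq># add_mset x M}"
    hence A: "A \<subseteq># add_mset x M" by simp
    show "A \<in> {A. A \<subseteq># M} \<union> add_mset x ` {A. A \<subseteq># M}"
    proof (cases "x \<in># A")
      case True
      then obtain B where "A = add_mset x B" by (meson mset_add)
      with A show ?thesis by auto
    next
      case False
      have "A \<subseteq># M"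
      proof (rule mset_subset_eqI)
        fix y show "count A y \<le> count M y"
          using mset_subset_eq_count[OF A, of y] False
          by (cases "y = x") (auto simp: not_in_iff)
      qed
      thus ?thesis by simp
    qed
  qed
  with add show ?case by (meson finite_UnI finite_imageI finite_subset)
qed

lemma finite_msplits [simp]: "finite (msplits M)"
proof (rule finite_subset)
  show "msplits M \<subseteq> {A. A \<subseteq># M} \<times> {A. A \<subseteq># M}" by auto
qed (simp add: finite_submultisets)

instantiation mseries :: (zero) zero
begin
lift_definition zero_mseries :: "'a mseries" is "\<lambda>_. 0" .
instance ..
end

instantiation mseries :: ("{zero,one}") one
begin
lift_definition one_mseries :: "'a mseries" is "\<lambda>M. if M = {#} then 1 else 0" .
instance ..
end

instantiation mseries :: (plus) plus
begin
lift_definition plus_mseries :: "'a mseries \<Rightarrow> 'a mseries \<Rightarrow> 'a mseries"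
  is "\<lambda>f g M. f M + g M" .
instance ..
end

instantiation mseries :: (minus) minus
begin
lift_definition minus_mseries :: "'a mseries \<Rightarrow> 'a mseries \<Rightarrow> 'a mseries"
  is "\<lambda>f g M. f M - g M" .
instance ..
end

instantiation mseries :: (uminus) uminus
begin
lift_definition uminus_mseries :: "'a mseries \<Rightarrow> 'a mseries" is "\<lambda>f M. - f M" .
instance ..
end

instantiation mseries :: (comm_semiring_0) times
begin
lift_definition times_mseries :: "'a mseries \<Rightarrow> 'a mseries \<Rightarrow> 'a mseries"
  is "\<lambda>f g M. \<Sum>(A, B)\<in>msplits M. f A * g B" .
instance ..
end

lemma mcoeff_simps [simp]:
  "mcoeff 0 M = 0"
  "mcoeff 1 M = (if M = {#} then 1 else 0)"
  "mcoeff (f + g) M = mcoeff f M + mcoeff g M"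
  "mcoeff (f' - g') M = mcoeff f' M - mcoeff g' M"
  "mcoeff (- h) M = - mcoeff h M"
  by (transfer; simp)+

lemma mcoeff_mult: "mcoeff (f * g) M = (\<Sum>(A, B)\<in>msplits M. mcoeff f A * mcoeff g B)"
  by transfer simp

instance mseries :: (comm_ring_1) comm_ring_1
proof
  fix a b c :: "'a mseries"
  show "a + b + c = a + (b + c)" "a + b = b + a" "0 + a = a" "- a + a = 0" "a - b = a + - b"
    by (rule mseries_eqI; simp)+
  show "(0 :: 'a mseries) \<noteq> 1"
  proof
    assume "(0 :: 'a mseries) = 1"
    hence "mcoeff (0 :: 'a mseries) {#} = mcoeff 1 {#}" by simp
    thus False by simp
  qed
  show "(a + b) * c = a * c + b * c"
    by (rule mseries_eqI) (simp add: mcoeff_mult sum.distrib ring_distribs split_def)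
  show "a * b = b * a"
    by (rule mseries_eqI, unfold mcoeff_mult,
        rule sum.reindex_bij_witness[of _ "\<lambda>(A, B). (B, A)" "\<lambda>(A, B). (B, A)"])
       (auto simp: ac_simps)
  show "1 * a = a"
  proof (rule mseries_eqI)
    fix M
    have "mcoeff (1 * a) M = (\<Sum>p\<in>msplits M. if p = ({#}, M) then mcoeff a M else 0)"
      unfolding mcoeff_mult by (rule sum.cong) (auto split: if_splits)
    also have "\<dots> = mcoeff a M"
      by simp
    finally show "mcoeff (1 * a) M = mcoeff a M" .
  qed
  show "a * b * c = a * (b * c)"
  proof (rule mseries_eqI)
    fix M
    have "mcoeff (a * b * c) M =
        (\<Sum>((A, B), (C, D))\<in>Sigma (msplits M) (\<lambda>p. msplits (fst p)).
           mcoeff a C * mcoeff b D * mcoeff c B)"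
      by (simp add: mcoeff_mult sum_distrib_right split_def sum.Sigma)
    also have "\<dots> =
        (\<Sum>((A, B), (C, D))\<in>Sigma (msplits M) (\<lambda>p. msplits (snd p)).
           mcoeff a A * (mcoeff b C * mcoeff c D))"
      by (rule sum.reindex_bij_witness
            [of _ "\<lambda>((A, B), (C, D)). ((A + C, D), (A, C))" "\<lambda>((A, B), (C, D)). ((C, D + B), (D, B))"])
         (auto simp: ac_simps)
    also have "\<dots> = mcoeff (a * (b * c)) M"
      by (simp add: mcoeff_mult sum_distrib_left split_def sum.Sigma)
    finally show "mcoeff (a * b * c) M = mcoeff (a * (b * c)) M" .
  qed
qed


section \<open>Fundamental quasisymmetric and complete homogeneous symmetric functions\<close>

definition F_seqs :: "nat set \<Rightarrow> nat \<Rightarrow> (nat \<Rightarrow> nat) set" where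
  "F_seqs S n = {i \<in> {1..n} \<rightarrow>\<^sub>E {1..}.
     \<forall>j\<in>{1..<n}. i j \<ge> i (j + 1) \<and> (j \<in> S \<longrightarrow> i j > i (j + 1))}"

definition seq_monomial :: "nat \<Rightarrow> (nat \<Rightarrow> nat) \<Rightarrow> nat multiset" where
  "seq_monomial n i = image_mset i (mset_set {1..n})"

text \<open>
  The infinite sum of monomials over \<open>F_seqs S n\<close> is taken coefficientwise: the coefficient of a
  monomial is the number of sequences producing it, which is finite.
\<close>

definition fund_qsym :: "nat set \<Rightarrow> nat \<Rightarrow> int mseries" where
  "fund_qsym S n = Abs_mseries (\<lambda>M. int (card {i \<in> F_seqs S n. seq_monomial n i = M}))"

lemma finite_F_seqs_monomial: "finite {i \<in> F_seqs S n. seq_monomial n i = M}"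
proof (rule finite_subset)
  show "{i \<in> F_seqs S n. seq_monomial n i = M} \<subseteq> {1..n} \<rightarrow>\<^sub>E set_mset M"
    by (auto simp: F_seqs_def seq_monomial_def PiE_iff extensional_def simp del: One_nat_def)
qed (auto intro: finite_PiE)

lemma fund_qsym_0: "fund_qsym {} 0 = 1"
  by (rule mseries_eqI) (auto simp: fund_qsym_def Abs_mseries_inverse F_seqs_def seq_monomial_def)

definition hsym :: "nat \<Rightarrow> int mseries" where
  "hsym n = Abs_mseries (\<lambda>M. if size M = n \<and> set_mset M \<subseteq> {1..} then 1 else 0)"

lemma hsym_0: "hsym 0 = 1"
  by (rule mseries_eqI) (auto simp: hsym_def Abs_mseries_inverse)


section \<open>Excedances and barred words\<close>

text \<open>Words of length \<open>n\<close> are functions on \<open>nat\<close>, of which only the values on \<open>{1..n}\<close> matter.\<close>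

definition DES :: "nat \<Rightarrow> (nat \<Rightarrow> 'a::linorder) \<Rightarrow> nat set" where
  "DES n w = {i \<in> {1..<n}. w i > w (i + 1)}"

datatype letter = Bar nat | Plain nat

text \<open>
  All barred letters precede all unbarred ones.  The single order
  \<open>Bar 1 < Bar 2 < \<dots> < Plain 0 < Plain 1 < \<dots>\<close> restricts to the orders used for
  permutations and for decorated permutations.
\<close>

instantiation letter :: linorder
begin

fun less_eq_letter :: "letter \<Rightarrow> letter \<Rightarrow> bool" where
  "Bar a \<le> Bar b \<longleftrightarrow> a \<le> b"
| "Bar a \<le> Plain b \<longleftrightarrow> True"
| "Plain a \<le> Bar b \<longleftrightarrow> False"
| "Plain a \<le> Plain b \<longleftrightarrow> a \<le> b"

definition less_letter :: "letter \<Rightarrow> letter \<Rightarrow> bool" where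
  "less_letter a b \<longleftrightarrow> a \<le> b \<and> \<not> b \<le> a"

instance
proof
  fix x y z :: letter
  show "x < y \<longleftrightarrow> x \<le> y \<and> \<not> y \<le> x" by (rule less_letter_def)
  show "x \<le> x" by (cases x) auto
  show "x \<le> y \<Longrightarrow> y \<le> z \<Longrightarrow> x \<le> z" by (cases x; cases y; cases z) auto
  show "x \<le> y \<Longrightarrow> y \<le> x \<Longrightarrow> x = y" by (cases x; cases y) auto
  show "x \<le> y \<or> y \<le> x" by (cases x; cases y) auto
qed

end

definition EXC :: "nat \<Rightarrow> (nat \<Rightarrow> nat) \<Rightarrow> nat set" where
  "EXC n \<sigma> = {i \<in> {1..n}. i < \<sigma> i}"

definition exc :: "nat \<Rightarrow> (nat \<Rightarrow> nat) \<Rightarrow> nat" where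
  "exc n \<sigma> = card (EXC n \<sigma>)"

definition barred :: "nat \<Rightarrow> (nat \<Rightarrow> nat) \<Rightarrow> nat \<Rightarrow> letter" where
  "barred n \<sigma> i = (if i \<in> EXC n \<sigma> then Bar (\<sigma> i) else Plain (\<sigma> i))"

definition DEX :: "nat \<Rightarrow> (nat \<Rightarrow> nat) \<Rightarrow> nat set" where
  "DEX n \<sigma> = DES n (barred n \<sigma>)"


section \<open>Eulerian quasisymmetric functions\<close>

text \<open>Polynomials in \<open>t\<close> have type \<open>int mseries poly\<close>; the variable \<open>t\<close> is \<open>monom 1 1\<close>.\<close>

definition Q :: "nat \<Rightarrow> int mseries poly" where
  "Q k = (\<Sum>\<sigma> | \<sigma> permutes {1..k}. monom (fund_qsym (DEX k \<sigma>) k) (exc k \<sigma>))"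

definition Qt :: "nat \<Rightarrow> int mseries poly" where
  "Qt n = [:hsym n:] + monom 1 1 * (\<Sum>k=1..n. smult (hsym (n - k)) (Q k))"

definition Qt_coeff :: "nat \<Rightarrow> nat \<Rightarrow> int mseries" where
  "Qt_coeff n j = coeff (Qt n) j"


section \<open>Decorated permutations\<close>

text \<open>
  A permutation \<open>\<pi>\<close> of \<open>S \<subseteq> {1..n}\<close> is represented by its one-line notation, extended by \<open>0\<close>
  outside \<open>{1..n}\<close>; it determines \<open>S\<close> and \<open>\<pi>\<close> because the elements of \<open>S\<close> are nonzero.
\<close>

definition one_line :: "nat set \<Rightarrow> (nat \<Rightarrow> nat) \<Rightarrow> nat \<Rightarrow> nat" where
  "one_line S \<pi> i = (if i \<in> S then \<pi> i else 0)"

definition decorated_perms :: "nat \<Rightarrow> (nat \<Rightarrow> nat) set" where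
  "decorated_perms n = {one_line S \<pi> | S \<pi>. S \<subseteq> {1..n} \<and> \<pi> permutes S}"

lemma finite_decorated_perms: "finite (decorated_perms n)"
proof -
  have "decorated_perms n \<subseteq>
      (\<lambda>(S, \<pi>). one_line S \<pi>) ` (SIGMA S:Pow {1..n}. {\<pi>. \<pi> permutes S})"
    by (auto simp: decorated_perms_def)
  moreover have "finite (SIGMA S:Pow {1..n}. {\<pi>. \<pi> permutes S})"
    by (rule finite_SigmaI) (auto intro!: finite_permutations intro: finite_subset)
  ultimately show ?thesis by (meson finite_imageI finite_subset)
qed

definition theta :: "nat \<Rightarrow> nat" where
  "theta = (\<lambda>_. 0)"

definition dexc :: "nat \<Rightarrow> (nat \<Rightarrow> nat) \<Rightarrow> int" where
  "dexc n \<sigma> = (if \<sigma> = theta then - 1 else int (exc n \<sigma>))"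

definition dDEX :: "nat \<Rightarrow> (nat \<Rightarrow> nat) \<Rightarrow> nat set" where
  "dDEX n \<sigma> = (if \<sigma> = theta then {} else DEX n \<sigma>)"

end

theory Submission
  imports Defs "HOL-Library.Product_Lexorder"
begin

text \<open>
  By the theory of P-partitions, the product of \<open>h\<^sub>m\<close> with the fundamental quasisymmetric function
  of the descent set of a word \<open>w\<close> is the sum of the functions of all words obtained from \<open>w\<close> by
  inserting \<open>m\<close> copies of a letter \<open>z\<close> that does not occur in \<open>w\<close>: a pair of a multiset of size
  \<open>m\<close> and a sequence compatible with \<open>w\<close> is merged by sorting.  Applied to the barred word of a
  permutation of \<open>[k]\<close> and \<open>z = 0\<close>, this produces the barred words of the decorated permutations
  with \<open>n - k\<close> zeros that standardize to it; standardization preserves the number of excedances.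
\<close>

section \<open>Words labelled by weakly decreasing indices\<close>

text \<open>The sequences in \<open>F_seqs\<close> decrease weakly while \<open>sorted\<close> asks
  for increase, hence the sign, and \<open>int\<close> to make room for it. The lexicographic order
  then lets an index repeat only where the letters do not descend.\<close>

definition desc_key :: "nat \<times> 'a \<Rightarrow> int \<times> 'a" where
  "desc_key p = (- int (fst p), snd p)"

text \<open>With an injective key, a multiset of pairs has only one sorted arrangement, so merging
  by sorting can be undone.\<close>

lemma inj_desc_key: "inj_on desc_key A"
  by (auto simp: inj_on_def desc_key_def prod_eq_iff)

lemma desc_key_le_iff:
  "desc_key p \<le> desc_key q \<longleftrightarrow> fst q \<le> fst p \<and> (snd q < snd p \<longrightarrow> fst q < fst p)"
  for p q :: "nat \<times> 'a::linorder"
  by (auto simp: desc_key_def less_eq_prod_def)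

text \<open>
  The inequalities defining \<^const>\<open>F_seqs\<close>, for the descent set of a word, say exactly that the
  list of pairs (index, letter) is sorted by \<^const>\<open>desc_key\<close>.
\<close>

definition labellings :: "'a::linorder list \<Rightarrow> (nat \<times> 'a) list set" where
  "labellings u = {xs. map snd xs = u \<and> sorted (map desc_key xs) \<and> 0 \<notin> fst ` set xs}"

text \<open>The shift passes from positions counted from 1 to list indices.\<close>

definition word_qsym :: "'a::linorder list \<Rightarrow> int mseries" where
  "word_qsym u = fund_qsym (DES (length u) (\<lambda>i. u ! (i - 1))) (length u)"

lemma mcoeff_fund_qsym:
  "mcoeff (fund_qsym S n) M = int (card {i \<in> F_seqs S n. seq_monomial n i = M})"
  by (simp add: fund_qsym_def Abs_mseries_inverse)

lemma mcoeff_hsym: "mcoeff (hsym n) M = (if size M = n \<and> 0 \<notin># M then 1 else 0)"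
  by (auto simp: hsym_def Abs_mseries_inverse subset_iff) (metis not_less_eq_eq le0 bot_nat_0.extremum_uniqueI)+

lemma mcoeff_sum: "mcoeff (sum f A) M = (\<Sum>a\<in>A. mcoeff (f a) M)"
  by (induction A rule: infinite_finite_induct) auto

lemma ball_upto_shift: "(\<forall>j\<in>{1..<n}. P j) \<longleftrightarrow> (\<forall>j. Suc j < n \<longrightarrow> P (Suc j))"
proof (intro iffI allI impI ballI)
  fix j assume *: "\<forall>j. Suc j < n \<longrightarrow> P (Suc j)" and j: "j \<in> {1..<n}"
  then show "P j" by (cases j) auto
qed auto

lemma seq_monomial_conv_list: "seq_monomial n i = mset (map i [1..<Suc n])"
proof -
  have "mset_set {1..n} = mset [1..<Suc n]"
    by (metis atLeastLessThanSuc_atLeastAtMost mset_upt)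
  then show ?thesis by (simp add: seq_monomial_def)
qed

text \<open>Sortedness need only be tested at neighbours, which is the form of the conditions in
  \<open>F_seqs\<close>; excluding the index 0 is positivity of the values.
  \<open>extensional\<close> fixes the values outside the word, which the zipped list cannot
  see.\<close>

lemma mem_F_seqs_iff:
  "i \<in> F_seqs (DES (length u) (\<lambda>i. u ! (i - 1))) (length u) \<longleftrightarrow>
     i \<in> extensional {1..length u} \<and> zip (map i [1..<Suc (length u)]) u \<in> labellings u"
proof -
  let ?n = "length u" and ?xs = "zip (map i [1..<Suc (length u)]) u"
  have len: "length ?xs = ?n" by (simp del: upt_Suc)
  have nth: "?xs ! j = (i (Suc j), u ! j)" if "j < ?n" for j
    using that by (simp del: upt_Suc)
  have "sorted (map desc_key ?xs) \<longleftrightarrow>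
      (\<forall>j. Suc j < ?n \<longrightarrow> desc_key (?xs ! j) \<le> desc_key (?xs ! Suc j))"
    by (auto simp: sorted_iff_nth_Suc len simp del: upt_Suc zip_map1)
  also have "\<dots> \<longleftrightarrow> (\<forall>j. Suc j < ?n \<longrightarrow> i (Suc j) \<ge> i (Suc (Suc j)) \<and>
      (u ! j > u ! Suc j \<longrightarrow> i (Suc j) > i (Suc (Suc j))))"
    by (auto simp: nth desc_key_le_iff simp del: upt_Suc zip_map1)
  finally have s: "sorted (map desc_key ?xs) \<longleftrightarrow> (\<forall>j. Suc j < ?n \<longrightarrow> i (Suc j) \<ge> i (Suc (Suc j)) \<and>
      (u ! j > u ! Suc j \<longrightarrow> i (Suc j) > i (Suc (Suc j))))" .
  have map_fst: "map fst ?xs = map i [1..<Suc ?n]" by (simp del: upt_Suc zip_map1)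
  have "fst ` set ?xs = i ` {1..?n}"
    unfolding set_map[symmetric] map_fst by (simp add: atLeastLessThanSuc_atLeastAtMost del: upt_Suc)
  then have z: "0 \<notin> fst ` set ?xs \<longleftrightarrow> (\<forall>j\<in>{1..?n}. 1 \<le> i j)"
    by (auto simp: image_iff Suc_le_eq simp del: upt_Suc zip_map1) 
  have m: "map snd ?xs = u" by (simp del: upt_Suc)
  show ?thesis
    unfolding F_seqs_def labellings_def mem_Collect_eq PiE_iff ball_upto_shift s z m
    by (auto simp: DES_def)
qed

text \<open>Zipping a sequence with the word is inverted by reading off the labels;
  \<open>restrict\<close> puts the result in the extensional form that \<open>F_seqs\<close>
  demands.\<close>

lemma mcoeff_word_qsym:
  "mcoeff (word_qsym u) M = int (card {xs \<in> labellings u. mset (map fst xs) = M})"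
proof -
  let ?n = "length u" let ?D = "DES ?n (\<lambda>i. u ! (i - 1))"
  let ?f = "\<lambda>i. zip (map i [1..<Suc ?n]) u"
  let ?g = "\<lambda>xs. restrict (\<lambda>j. fst (xs ! (j - 1))) {1..?n}"
  have fg: "?f (?g xs) = xs" if "xs \<in> labellings u" for xs :: "(nat \<times> 'a) list"
  proof -
    have "map snd xs = u" using that by (simp add: labellings_def)
    then show ?thesis
      by (intro nth_equalityI) (auto simp: prod_eq_iff simp del: upt_Suc)
  qed
  have "bij_betw ?f {i \<in> F_seqs ?D ?n. seq_monomial ?n i = M}
      {xs \<in> labellings u. mset (map fst xs) = M}"
  proof (rule bij_betw_byWitness[where f' = ?g])
    show "\<forall>i\<in>{i \<in> F_seqs ?D ?n. seq_monomial ?n i = M}. ?g (?f i) = i"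
      by (auto simp: mem_F_seqs_iff fun_eq_iff restrict_def extensional_def simp del: upt_Suc One_nat_def)
    show "\<forall>xs\<in>{xs \<in> labellings u. mset (map fst xs) = M}. ?f (?g xs) = xs"
      using fg by blast
    show "?f ` {i \<in> F_seqs ?D ?n. seq_monomial ?n i = M} \<subseteq> {xs \<in> labellings u. mset (map fst xs) = M}"
      by (auto simp: mem_F_seqs_iff seq_monomial_conv_list simp del: upt_Suc zip_map1 mset_map One_nat_def)
    show "?g ` {xs \<in> labellings u. mset (map fst xs) = M} \<subseteq> {i \<in> F_seqs ?D ?n. seq_monomial ?n i = M}"
    proof clarify
      fix xs assume xs: "xs \<in> labellings u" and M: "M = mset (map fst xs)"
      have "map (?g xs) [1..<Suc ?n] = map fst (?f (?g xs))"
        by (simp del: upt_Suc zip_map1)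
      then show "?g xs \<in> F_seqs ?D ?n \<and> seq_monomial ?n (?g xs) = mset (map fst xs)"
        unfolding mem_F_seqs_iff seq_monomial_conv_list fg[OF xs] using xs by simp
    qed
  qed
  then show ?thesis
    by (simp add: word_qsym_def mcoeff_fund_qsym bij_betw_same_card)
qed

lemma finite_labellings: "finite {xs \<in> labellings u. mset (map fst xs) = M}"
proof (rule finite_subset)
  show "{xs \<in> labellings u. mset (map fst xs) = M} \<subseteq>
      {xs. set xs \<subseteq> set_mset M \<times> set u \<and> length xs = length u}"
    by (force simp: labellings_def)
  show "finite {xs. set xs \<subseteq> set_mset M \<times> set u \<and> length xs = length u}"
    by (rule finite_lists_length_eq) auto
qed

section \<open>Multiplying by \<open>hsym\<close> inserts copies of a new letter\<close>

text \<open>The prescribed length makes the number of copies of \<open>z\<close> exactly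
  \<open>m\<close>. Words are collected in a set, so indistinguishable ways of inserting count
  once.\<close>

definition insertions :: "'a \<Rightarrow> nat \<Rightarrow> 'a list \<Rightarrow> 'a list set" where
  "insertions z m w = {u. length u = m + length w \<and> filter (\<lambda>x. x \<noteq> z) u = w}"

lemma finite_insertions: "finite (insertions z m w)"
proof (rule finite_subset)
  show "insertions z m w \<subseteq> {u. set u \<subseteq> insert z (set w) \<and> length u = m + length w}"
    by (auto simp: insertions_def)
  show "finite {u. set u \<subseteq> insert z (set w) \<and> length u = m + length w}"
    by (rule finite_lists_length_eq) auto
qed

text \<open>Coefficients of \<open>hsym\<close> are 0 or 1, so a coefficient of the product counts
  pairs of a multiset \<open>A\<close> of \<open>m\<close> positive labels and a labelling of
  \<open>w\<close>. Merging by sorting and splitting by the letter \<open>z\<close> are mutually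
  inverse, since a sublist of a sorted list is sorted and the key is injective.\<close>

lemma hsym_times_word_qsym:
  fixes z :: "'a::linorder"
  assumes z: "z \<notin> set w"
  shows "hsym m * word_qsym w = (\<Sum>u\<in>insertions z m w. word_qsym u)"
proof (rule mseries_eqI)
  fix M
  let ?P = "{(A, B) \<in> msplits M. size A = m \<and> 0 \<notin># A}"
  let ?L = "\<lambda>u M. {xs \<in> labellings u. mset (map fst xs) = M}"
  \<comment> \<open>The labels on \<open>z\<close> give the monomial taken from \<open>hsym\<close>;
    the other pairs, in their old order, label \<open>w\<close>.\<close>
  let ?split = "\<lambda>ys :: (nat \<times> 'a) list.
     let A = mset (map fst (filter (\<lambda>p. snd p = z) ys)); xs = filter (\<lambda>p. snd p \<noteq> z) ys
     in ((A, mset (map fst xs)), xs)"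
  let ?merge = "\<lambda>((A, B), xs).
     sort_key desc_key (xs @ map (\<lambda>a. (a, z)) (sorted_list_of_multiset A))"
  have fP: "finite ?P" by (rule finite_subset[OF _ finite_msplits[of M]]) auto
  have "mcoeff (hsym m * word_qsym w) M = (\<Sum>(A, B)\<in>?P. int (card (?L w B)))"
    unfolding mcoeff_mult mcoeff_hsym mcoeff_word_qsym
    by (rule sum.mono_neutral_cong_right) (auto split: if_splits)
  also have "\<dots> = int (card (Sigma ?P (\<lambda>(A, B). ?L w B)))"
    using fP finite_labellings[of w] by (subst card_SigmaI) (auto simp: split_def)
  also have "card (Sigma ?P (\<lambda>(A, B). ?L w B)) = card (\<Union>u\<in>insertions z m w. ?L u M)"
  proof (rule sym, rule bij_betw_same_card, rule bij_betw_byWitness[where f = ?split and f' = ?merge])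
    show "\<forall>ys\<in>\<Union>u\<in>insertions z m w. ?L u M. ?merge (?split ys) = ys"
    proof
      fix ys assume "ys \<in> (\<Union>u\<in>insertions z m w. ?L u M)"
      then have ys: "sorted (map desc_key ys)" by (auto simp: labellings_def)
      \<comment> \<open>These pairs all carry the letter \<open>z\<close>, so keeping only their
        labels loses nothing.\<close>
      have "image_mset (\<lambda>p. (fst p, z)) (filter_mset (\<lambda>p. snd p = z) (mset ys))
          = filter_mset (\<lambda>p. snd p = z) (mset ys)"
        by (induction ys) auto
      then have "mset (filter (\<lambda>p. snd p \<noteq> z) ys @ map (\<lambda>a. (a, z)) (sorted_list_of_multiset
          (mset (map fst (filter (\<lambda>p. snd p = z) ys))))) = mset ys"
        by (simp add: image_mset.compositionality comp_def)
      from sort_key_inj_key_eq[OF this inj_desc_key ys]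
      show "?merge (?split ys) = ys" by (simp add: Let_def)
    qed
    show "\<forall>t\<in>Sigma ?P (\<lambda>(A, B). ?L w B). ?split (?merge t) = t"
    proof
      fix t assume "t \<in> Sigma ?P (\<lambda>(A, B). ?L w B)"
      then obtain A xs where t: "t = ((A, mset (map fst xs)), xs)" and xs: "xs \<in> labellings w"
        by auto
      have s: "sorted (map desc_key xs)" and "map snd xs = w"
        using xs by (auto simp: labellings_def)
      then have "\<forall>p\<in>set xs. snd p \<noteq> z" using z by (metis image_eqI set_map)
      then have f: "filter (\<lambda>p. snd p \<noteq> z) xs = xs" "filter (\<lambda>p. snd p = z) xs = []"
        by (simp_all add: filter_empty_conv)
      \<comment> \<open>Filtering commutes with sorting, so recovering \<open>xs\<close> comes down
        to its being sorted already.\<close>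
      have "sort_key desc_key xs = xs"
        by (rule sort_key_inj_key_eq) (use s inj_desc_key in auto)
      then show "?split (?merge t) = t"
        by (simp add: t Let_def filter_sort f filter_map comp_def image_mset.compositionality)
    qed
    show "?split ` (\<Union>u\<in>insertions z m w. ?L u M) \<subseteq> Sigma ?P (\<lambda>(A, B). ?L w B)"
    proof (rule image_subsetI)
      fix ys assume "ys \<in> (\<Union>u\<in>insertions z m w. ?L u M)"
      then obtain u where u: "u \<in> insertions z m w" and ys: "ys \<in> labellings u"
        and M: "M = mset (map fst ys)" by blast
      have u': "u = map snd ys" and s: "sorted (map desc_key ys)" and 0: "0 \<notin> fst ` set ys"
        using ys by (auto simp: labellings_def)
      have w: "w = map snd (filter (\<lambda>p. snd p \<noteq> z) ys)" and l: "length ys = m + length w"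
        using u by (auto simp: insertions_def u' filter_map comp_def)
      \<comment> \<open>The pairs with another letter number \<open>length w\<close>, so the surplus
        in length counts the copies of \<open>z\<close>.\<close>
      have "length (filter (\<lambda>p. snd p = z) ys) = m"
        using sum_length_filter_compl[of "\<lambda>p. snd p = z" ys] l by (simp add: w)
      then have "size (filter_mset (\<lambda>p. snd p = z) (mset ys)) = m"
        by (metis size_mset mset_filter)
      moreover have "image_mset fst (filter_mset (\<lambda>p. snd p = z) (mset ys)) +
          image_mset fst (filter_mset (\<lambda>p. snd p \<noteq> z) (mset ys)) = M"
        unfolding M by (metis image_mset_union mset_map multiset_partition)
      ultimately show "?split ys \<in> Sigma ?P (\<lambda>(A, B). ?L w B)"
        using 0 s by (auto simp: Let_def labellings_def w sorted_filter image_iff)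
    qed
    show "?merge ` Sigma ?P (\<lambda>(A, B). ?L w B) \<subseteq> (\<Union>u\<in>insertions z m w. ?L u M)"
    proof (rule image_subsetI)
      fix t assume "t \<in> Sigma ?P (\<lambda>(A, B). ?L w B)"
      then obtain A xs where t: "t = ((A, mset (map fst xs)), xs)"
        and A: "A + mset (map fst xs) = M" "m = size A" "0 \<notin># A" and xs: "xs \<in> labellings w"
        by auto
      have s: "sorted (map desc_key xs)" and w: "w = map snd xs" and 0: "0 \<notin> fst ` set xs"
        using xs by (auto simp: labellings_def)
      have "\<forall>p\<in>set xs. snd p \<noteq> z" using z unfolding w set_map by (metis image_eqI)
      then have f: "filter (\<lambda>p. snd p \<noteq> z) xs = xs"
        by simp
      have xs': "sort_key desc_key xs = xs"
        by (rule sort_key_inj_key_eq) (use s inj_desc_key in auto)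
      let ?ys = "?merge ((A, mset (map fst xs)), xs)"
      have "mset (map fst ?ys) = M"
        using A by (simp add: image_mset.compositionality comp_def add.commute)
      moreover have "?ys \<in> labellings (map snd ?ys)"
        using 0 A by (auto simp: labellings_def)
      moreover have "map snd ?ys \<in> insertions z m w"
        using A size_mset[of "sorted_list_of_multiset A"]
        by (simp add: insertions_def filter_map comp_def filter_sort f xs' w del: size_mset)
      ultimately show "?merge t \<in> (\<Union>u\<in>insertions z m w. ?L u M)"
        unfolding t by blast
    qed
  qed
  also have "int (card (\<Union>u\<in>insertions z m w. ?L u M)) = (\<Sum>u\<in>insertions z m w. int (card (?L u M)))"
  proof -
    \<comment> \<open>A labelling determines its word through \<open>map snd\<close>, so different
      words contribute disjoint sets.\<close>
    have "card (\<Union>u\<in>insertions z m w. ?L u M) = (\<Sum>u\<in>insertions z m w. card (?L u M))"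
      by (rule card_UN_disjoint, rule finite_insertions, use finite_labellings in blast)
        (auto simp: labellings_def)
    then show ?thesis by simp
  qed
  also have "\<dots> = mcoeff (\<Sum>u\<in>insertions z m w. word_qsym u) M"
    by (simp add: mcoeff_word_qsym mcoeff_sum)
  finally show "mcoeff (hsym m * word_qsym w) M = mcoeff (\<Sum>u\<in>insertions z m w. word_qsym u) M" .
qed

lemma fund_qsym_DES: "fund_qsym (DES n f) n = word_qsym (map f [1..<Suc n])"
proof -
  have "DES n f = DES n (\<lambda>i. map f [1..<Suc n] ! (i - 1))"
    by (auto simp: DES_def simp del: upt_Suc)
  then show ?thesis by (simp add: word_qsym_def del: upt_Suc)
qed

text \<open>Inserting \<open>n\<close> copies of a letter into the empty word gives only the
  constant word, which has no descents. This supplies the term of \<open>theta\<close>.\<close>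

lemma fund_qsym_empty: "fund_qsym {} n = hsym n"
proof -
  have "insertions (0::nat) n [] = {replicate n 0}"
    by (auto simp: insertions_def filter_empty_conv intro: replicate_eqI)
  moreover have "word_qsym ([] :: nat list) = 1"
    by (simp add: word_qsym_def DES_def fund_qsym_0)
  ultimately have "hsym n = word_qsym (replicate n (0::nat))"
    using hsym_times_word_qsym[of "0::nat" "[]" n] by simp
  also have "replicate n 0 = map (\<lambda>_. 0::nat) [1..<Suc n]"
    by (simp add: map_replicate_const del: upt_Suc)
  also have "word_qsym \<dots> = fund_qsym {} n"
    unfolding fund_qsym_DES[symmetric] by (simp add: DES_def)
  finally show ?thesis by simp
qed

section \<open>Increasing enumeration of a support and words spread over it\<close>

text \<open>For finite \<open>S\<close>, the increasing bijection from \<open>{1..card S}\<close>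
  onto \<open>S\<close>; \<open>enumerate\<close> counts from 0, words from 1.\<close>

definition enum :: "nat set \<Rightarrow> nat \<Rightarrow> nat" where
  "enum S j = enumerate S (j - 1)"

text \<open>The standardization map, meaningful on the elements of a finite
  \<open>S\<close>.\<close>

definition rank :: "nat set \<Rightarrow> nat \<Rightarrow> nat" where
  "rank S = inv_into {1..card S} (enum S)"

lemma bij_betw_enum: "finite S \<Longrightarrow> bij_betw (enum S) {1..card S} S"
proof -
  assume "finite S"
  then have "bij_betw (enumerate S) {..<card S} S" by (rule finite_bij_enumerate)
  moreover have "bij_betw (\<lambda>j. j - 1) {1..card S} {..<card S}"
    by (rule bij_betw_byWitness[where f' = Suc]) auto
  ultimately have "bij_betw (enumerate S \<circ> (\<lambda>j. j - 1)) {1..card S} S"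
    by (rule bij_betw_trans[rotated])
  then show ?thesis by (simp add: comp_def enum_def[abs_def])
qed

lemma enum_less_iff:
  assumes "finite S" "i \<in> {1..card S}" "j \<in> {1..card S}"
  shows "enum S i < enum S j \<longleftrightarrow> i < j"
proof -
  have "enum S a < enum S b" if "a \<in> {1..card S}" "b \<in> {1..card S}" "a < b" for a b
    unfolding enum_def by (rule finite_enumerate_mono) (use that assms in auto)
  then show ?thesis using assms by (metis less_asym linorder_neqE_nat)
qed

lemma enum_in: "finite S \<Longrightarrow> j \<in> {1..card S} \<Longrightarrow> enum S j \<in> S"
  using bij_betw_enum bij_betwE by blast

lemma rank_in: "finite S \<Longrightarrow> i \<in> S \<Longrightarrow> rank S i \<in> {1..card S}"
  unfolding rank_def by (metis bij_betw_enum bij_betw_imp_surj_on inv_into_into)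

lemma enum_rank [simp]: "finite S \<Longrightarrow> i \<in> S \<Longrightarrow> enum S (rank S i) = i"
  unfolding rank_def by (metis bij_betw_enum bij_betw_inv_into_right)

lemma rank_enum [simp]: "finite S \<Longrightarrow> j \<in> {1..card S} \<Longrightarrow> rank S (enum S j) = j"
  unfolding rank_def by (metis bij_betw_enum bij_betw_inv_into_left)

text \<open>Two strictly increasing lists with the same set of entries coincide.\<close>

lemma map_enum:
  assumes "S \<subseteq> {1..n}"
  shows "map (enum S) [1..<Suc (card S)] = filter (\<lambda>i. i \<in> S) [1..<Suc n]"
proof (rule sorted_distinct_set_unique)
  have fin: "finite S" using assms finite_subset by blast
  have "enum S i \<le> enum S j" if "i \<in> {1..card S}" "j \<in> {1..card S}" "i \<le> j" for i j
    using enum_less_iff[OF fin that(2,1)] that(3) by simp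
  then have "sorted_wrt (\<lambda>i j. enum S i \<le> enum S j) [1..<Suc (card S)]"
    by (intro sorted_wrt_mono_rel[OF _ sorted_upt]) (auto simp del: upt_Suc)
  then show "sorted (map (enum S) [1..<Suc (card S)])" by (simp add: sorted_wrt_map del: upt_Suc)
  have "inj_on (enum S) {1..card S}" using bij_betw_enum[OF fin] by (rule bij_betw_imp_inj_on)
  then show "distinct (map (enum S) [1..<Suc (card S)])"
    by (simp add: distinct_map atLeastLessThanSuc_atLeastAtMost del: upt_Suc)
  have "enum S ` {1..card S} = S" using bij_betw_enum[OF fin] by (rule bij_betw_imp_surj_on)
  then show "set (map (enum S) [1..<Suc (card S)]) = set (filter (\<lambda>i. i \<in> S) [1..<Suc n])"
    using assms by (auto simp: atLeastLessThanSuc_atLeastAtMost simp del: upt_Suc)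
qed (auto intro: sorted_wrt_filter simp del: upt_Suc)

text \<open>An insertion described by the positions \<open>S\<close> that it leaves to the letters
  of the original word \<open>f\<close>.\<close>

definition spread :: "'a \<Rightarrow> nat set \<Rightarrow> (nat \<Rightarrow> 'a) \<Rightarrow> nat \<Rightarrow> 'a" where
  "spread z S f i = (if i \<in> S then f (rank S i) else z)"

lemma filter_spread:
  assumes "S \<subseteq> {1..n}" "z \<notin> f ` {1..card S}"
  shows "filter (\<lambda>x. x \<noteq> z) (map (spread z S f) [1..<Suc n]) = map f [1..<Suc (card S)]"
proof -
  have fin: "finite S" using assms finite_subset by blast
  have iff: "spread z S f i \<noteq> z \<longleftrightarrow> i \<in> S" for i
    using assms(2) rank_in[OF fin, of i] by (auto simp: spread_def)
  have "filter (\<lambda>x. x \<noteq> z) (map (spread z S f) [1..<Suc n]) =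
      map (spread z S f) (filter (\<lambda>i. i \<in> S) [1..<Suc n])"
    by (simp add: filter_map comp_def iff del: upt_Suc)
  also have "\<dots> = map (\<lambda>j. spread z S f (enum S j)) [1..<Suc (card S)]"
    unfolding map_enum[OF assms(1), symmetric] by (simp add: comp_def del: upt_Suc)
  also have "\<dots> = map f [1..<Suc (card S)]"
    using fin by (auto simp: spread_def enum_in simp del: upt_Suc)
  finally show ?thesis .
qed

text \<open>Induction along both words: the places of \<open>z\<close> agree, and every other place
  consumes one letter of the common filtered word.\<close>

lemma filter_neq_inject:
  assumes "list_all2 (\<lambda>x y. x = z \<longleftrightarrow> y = z) u v"
    and "filter (\<lambda>x. x \<noteq> z) u = filter (\<lambda>x. x \<noteq> z) v"
  shows "u = v"
  using assms by (induction rule: list_all2_induct) (auto split: if_splits)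

text \<open>Since \<open>f\<close> avoids \<open>z\<close>, the positions of the old letters are
  visible in the new word, and they determine it.\<close>

lemma bij_betw_spread:
  assumes z: "z \<notin> f ` {1..k}" and k: "k \<le> n"
  shows "bij_betw (\<lambda>S. map (spread z S f) [1..<Suc n]) {S. S \<subseteq> {1..n} \<and> card S = k}
           (insertions z (n - k) (map f [1..<Suc k]))"
proof (rule bij_betw_byWitness[where f' = "\<lambda>u. {i\<in>{1..n}. u ! (i - 1) \<noteq> z}"])
  have iff: "spread z S f i = z \<longleftrightarrow> i \<notin> S" if "S \<subseteq> {1..n}" "card S = k" for S i
  proof -
    have "finite S" using that finite_subset by blast
    then show ?thesis using z rank_in[of S i] that by (auto simp: spread_def)
  qed
  show "\<forall>S\<in>{S. S \<subseteq> {1..n} \<and> card S = k}.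
      {i\<in>{1..n}. map (spread z S f) [1..<Suc n] ! (i - 1) \<noteq> z} = S"
  proof clarify
    fix S assume S: "S \<subseteq> {1..n}" "k = card S"
    have "map (spread z S f) [1..<Suc n] ! (i - 1) = spread z S f i" if "i \<in> {1..n}" for i
      using that by (cases i) (auto simp del: upt_Suc)
    then show "{i\<in>{1..n}. map (spread z S f) [1..<Suc n] ! (i - 1) \<noteq> z} = S"
      using S iff[of S] by auto
  qed
  show "(\<lambda>S. map (spread z S f) [1..<Suc n]) ` {S. S \<subseteq> {1..n} \<and> card S = k}
      \<subseteq> insertions z (n - k) (map f [1..<Suc k])"
    using filter_spread[of _ n z f] z k by (auto simp: insertions_def simp del: upt_Suc)
  have card: "card {i\<in>{1..n}. u ! (i - 1) \<noteq> z} = k"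
    if "u \<in> insertions z (n - k) (map f [1..<Suc k])" for u
  proof -
    have u: "length u = n" "filter (\<lambda>x. x \<noteq> z) u = map f [1..<Suc k]"
      using that k by (auto simp: insertions_def simp del: upt_Suc)
    have "{i\<in>{1..n}. u ! (i - 1) \<noteq> z} = Suc ` {i. i < length u \<and> u ! i \<noteq> z}"
      using u(1) by (auto simp: image_iff) (metis Suc_pred Suc_le_eq less_Suc_eq_le zero_less_Suc)
    then have "card {i\<in>{1..n}. u ! (i - 1) \<noteq> z} = length (filter (\<lambda>x. x \<noteq> z) u)"
      by (simp add: card_image length_filter_conv_card)
    then show ?thesis by (simp add: u(2) del: upt_Suc)
  qed
  then show "(\<lambda>u. {i\<in>{1..n}. u ! (i - 1) \<noteq> z}) ` insertions z (n - k) (map f [1..<Suc k])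
      \<subseteq> {S. S \<subseteq> {1..n} \<and> card S = k}" by auto
  show "\<forall>u\<in>insertions z (n - k) (map f [1..<Suc k]).
      map (spread z {i\<in>{1..n}. u ! (i - 1) \<noteq> z} f) [1..<Suc n] = u"
  proof
    fix u assume u: "u \<in> insertions z (n - k) (map f [1..<Suc k])"
    let ?S = "{i\<in>{1..n}. u ! (i - 1) \<noteq> z}"
    have S: "?S \<subseteq> {1..n}" and cS: "card ?S = k" using card[OF u] by auto
    show "map (spread z ?S f) [1..<Suc n] = u"
    proof (rule filter_neq_inject)
      show "list_all2 (\<lambda>x y. x = z \<longleftrightarrow> y = z) (map (spread z ?S f) [1..<Suc n]) u"
      proof (rule list_all2_all_nthI)
        show "length (map (spread z ?S f) [1..<Suc n]) = length u"
          using u k by (simp add: insertions_def del: upt_Suc)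
        fix i assume "i < length (map (spread z ?S f) [1..<Suc n])"
        then have i: "i < n" by (simp del: upt_Suc)
        then have "map (spread z ?S f) [1..<Suc n] ! i = spread z ?S f (Suc i)"
          by (simp del: upt_Suc)
        with iff[OF S cS, of "Suc i"] i
        show "map (spread z ?S f) [1..<Suc n] ! i = z \<longleftrightarrow> u ! i = z" by simp
      qed
      show "filter (\<lambda>x. x \<noteq> z) (map (spread z ?S f) [1..<Suc n]) = filter (\<lambda>x. x \<noteq> z) u"
        using filter_spread[OF S, of z f] z u unfolding cS by (simp add: insertions_def del: upt_Suc)
    qed
  qed
qed

text \<open>Trades inserted words for subsets of positions, which will be the supports of decorated
  permutations.\<close>

corollary hsym_times_fund_qsym:
  fixes f :: "nat \<Rightarrow> 'a::linorder"
  assumes "z \<notin> f ` {1..k}" "k \<le> n"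
  shows "hsym (n - k) * fund_qsym (DES k f) k =
    (\<Sum>S | S \<subseteq> {1..n} \<and> card S = k. fund_qsym (DES n (spread z S f)) n)"
proof -
  have "z \<notin> set (map f [1..<Suc k])"
    using assms(1) by (simp add: atLeastLessThanSuc_atLeastAtMost del: upt_Suc)
  from hsym_times_word_qsym[OF this] show ?thesis
    unfolding fund_qsym_DES by (simp only: sum.reindex_bij_betw[OF bij_betw_spread[OF assms]])
qed

section \<open>Decorated permutations as permutations spread over their support\<close>

text \<open>Positions and values are both transported by \<open>enum S\<close>, giving the one-line
  word of the permutation of \<open>S\<close> that standardizes to \<open>\<sigma>\<close>.\<close>

definition decorate :: "nat set \<Rightarrow> (nat \<Rightarrow> nat) \<Rightarrow> nat \<Rightarrow> nat" where
  "decorate S \<sigma> = spread 0 S (\<lambda>j. enum S (\<sigma> j))"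

text \<open>A one-line word determines its support and its permutation; conjugation by
  \<open>enum S\<close> then standardizes the permutation.\<close>

lemma sum_decorated_perms:
  "(\<Sum>\<tau>\<in>decorated_perms n. g \<tau>) =
   (\<Sum>S\<in>Pow {1..n}. \<Sum>\<sigma> | \<sigma> permutes {1..card S}. g (decorate S \<sigma>))"
proof -
  let ?D = "SIGMA S:Pow {1..n}. {\<pi>. \<pi> permutes S}"
  \<comment> \<open>As 0 is not in \<open>S\<close>, the nonzero entries mark \<open>S\<close>, and
    a permutation of \<open>S\<close> fixes everything outside it. This provides an explicit left
    inverse of \<open>one_line\<close>.\<close>
  have *: "S = {i. one_line S \<pi> i \<noteq> 0}" "\<pi> = (\<lambda>i. if one_line S \<pi> i \<noteq> 0 then one_line S \<pi> i else i)"
    if "S \<subseteq> {1..n}" "\<pi> permutes S" for S \<pi>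
  proof -
    have pos: "\<pi> i \<noteq> 0" if "i \<in> S" for i
      using \<open>S \<subseteq> {1..n}\<close> permutes_in_image[OF \<open>\<pi> permutes S\<close>, of i] that by auto
    then show "S = {i. one_line S \<pi> i \<noteq> 0}" by (auto simp: one_line_def)
    show "\<pi> = (\<lambda>i. if one_line S \<pi> i \<noteq> 0 then one_line S \<pi> i else i)"
    proof
      fix i show "\<pi> i = (if one_line S \<pi> i \<noteq> 0 then one_line S \<pi> i else i)"
        using pos permutes_not_in[OF \<open>\<pi> permutes S\<close>] by (cases "i \<in> S") (simp_all add: one_line_def)
    qed
  qed
  have inj: "inj_on (\<lambda>(S, \<pi>). one_line S \<pi>) ?D"
    by (rule inj_on_inverseI[where g = "\<lambda>\<tau>. ({i. \<tau> i \<noteq> 0}, \<lambda>i. if \<tau> i \<noteq> 0 then \<tau> i else i)"])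
      (clarsimp simp only: mem_Sigma_iff Pow_iff mem_Collect_eq prod.case prod.inject *[symmetric] simp_thms)
  have dec: "decorated_perms n = (\<lambda>(S, \<pi>). one_line S \<pi>) ` ?D"
    by (auto simp: decorated_perms_def image_iff)
  have "(\<Sum>\<tau>\<in>decorated_perms n. g \<tau>) = (\<Sum>(S, \<pi>)\<in>?D. g (one_line S \<pi>))"
    unfolding dec sum.reindex[OF inj] by (simp add: split_def comp_def)
  also have "\<dots> = (\<Sum>S\<in>Pow {1..n}. \<Sum>\<pi> | \<pi> permutes S. g (one_line S \<pi>))"
    by (rule sum.Sigma[symmetric]) (auto intro!: finite_permutations intro: finite_subset)
  also have "\<dots> = (\<Sum>S\<in>Pow {1..n}. \<Sum>\<sigma> | \<sigma> permutes {1..card S}. g (decorate S \<sigma>))"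
  proof (rule sum.cong[OF refl])
    fix S assume "S \<in> Pow {1..n}"
    then have "finite S" using finite_subset by blast
    note bij = bij_betw_permutations[OF bij_betw_enum[OF this]]
    have "one_line S (\<lambda>x. if x \<in> S then enum S (\<sigma> (inv_into {1..card S} (enum S) x)) else x)
        = decorate S \<sigma>" for \<sigma>
      by (auto simp: one_line_def decorate_def spread_def rank_def fun_eq_iff)
    then show "(\<Sum>\<pi> | \<pi> permutes S. g (one_line S \<pi>)) =
        (\<Sum>\<sigma> | \<sigma> permutes {1..card S}. g (decorate S \<sigma>))"
      by (simp add: sum.reindex_bij_betw[OF bij, symmetric])
  qed
  finally show ?thesis .
qed

lemma less_letter_simps [simp]:
  "Bar a < Bar b \<longleftrightarrow> a < b" "Bar a < Plain b" "\<not> Plain a < Bar b" "Plain a < Plain b \<longleftrightarrow> a < b"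
  by (auto simp: less_letter_def)

context
  fixes n :: nat and S :: "nat set" and \<sigma> :: "nat \<Rightarrow> nat"
  assumes S: "S \<subseteq> {1..n}" and \<sigma>: "\<sigma> permutes {1..card S}"
begin

private lemma finite_S: "finite S"
  using S finite_subset by blast

text \<open>\<open>enum S\<close> is increasing, so relabelling does not affect how a value compares
  with its position, and a 0 never exceeds its position.\<close>

lemma EXC_decorate: "EXC n (decorate S \<sigma>) = enum S ` EXC (card S) \<sigma>"
proof -
  have "i \<in> EXC n (decorate S \<sigma>) \<longleftrightarrow> i \<in> S \<and> rank S i \<in> EXC (card S) \<sigma>" for i
  proof (cases "i \<in> S")
    case True
    have "rank S i \<in> {1..card S}" "\<sigma> (rank S i) \<in> {1..card S}"
      using rank_in[OF finite_S True] permutes_in_image[OF \<sigma>] by auto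
    then show ?thesis
      using True S enum_less_iff[OF finite_S, of "rank S i" "\<sigma> (rank S i)"] finite_S
      by (auto simp: EXC_def decorate_def spread_def)
  qed (auto simp: EXC_def decorate_def spread_def)
  moreover have "i \<in> S \<and> rank S i \<in> EXC (card S) \<sigma> \<longleftrightarrow> i \<in> enum S ` EXC (card S) \<sigma>" for i
    using finite_S enum_in[OF finite_S] by (auto simp: EXC_def image_iff)
  ultimately show ?thesis by blast
qed

lemma exc_decorate: "exc n (decorate S \<sigma>) = exc (card S) \<sigma>"
  unfolding exc_def EXC_decorate
  by (rule card_image, rule inj_on_subset[OF bij_betw_imp_inj_on[OF bij_betw_enum[OF finite_S]]])
    (auto simp: EXC_def)

text \<open>Relabelling the nonzero letters increasingly leaves the descents of the barred word alone.\<close>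

lemma DEX_decorate: "DEX n (decorate S \<sigma>) = DES n (spread (Plain 0) S (barred (card S) \<sigma>))"
proof -
  let ?b = "barred n (decorate S \<sigma>)" and ?c = "spread (Plain 0) S (barred (card S) \<sigma>)"
  have in_S: "?b i = (if rank S i \<in> EXC (card S) \<sigma> then Bar (enum S (\<sigma> (rank S i))) else Plain (enum S (\<sigma> (rank S i))))"
      "?c i = (if rank S i \<in> EXC (card S) \<sigma> then Bar (\<sigma> (rank S i)) else Plain (\<sigma> (rank S i)))"
      "\<sigma> (rank S i) \<in> {1..card S}" "enum S (\<sigma> (rank S i)) > 0" if "i \<in> S" for i
  proof -
    show *: "\<sigma> (rank S i) \<in> {1..card S}"
      using rank_in[OF finite_S that] permutes_in_image[OF \<sigma>] by auto
    show "enum S (\<sigma> (rank S i)) > 0" using enum_in[OF finite_S *] S by auto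
    have "i \<in> EXC n (decorate S \<sigma>) \<longleftrightarrow> rank S i \<in> EXC (card S) \<sigma>"
      unfolding EXC_decorate using that finite_S by (auto simp: image_iff EXC_def)
    then show "?b i = (if rank S i \<in> EXC (card S) \<sigma> then Bar (enum S (\<sigma> (rank S i))) else Plain (enum S (\<sigma> (rank S i))))"
      "?c i = (if rank S i \<in> EXC (card S) \<sigma> then Bar (\<sigma> (rank S i)) else Plain (\<sigma> (rank S i)))"
      using that by (auto simp: barred_def spread_def decorate_def)
  qed
  have not_S: "?b i = Plain 0" "?c i = Plain 0" if "i \<notin> S" for i
    using that by (auto simp: barred_def EXC_def spread_def decorate_def)
  \<comment> \<open>Inside \<open>S\<close> the bars agree and \<open>enum S\<close> preserves
    order. Against \<open>Plain 0\<close>, barred letters are smaller and unbarred ones larger in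
    both words, because their values are positive.\<close>
  have "?b i < ?b j \<longleftrightarrow> ?c i < ?c j" for i j
  proof (cases "i \<in> S \<and> j \<in> S")
    case True
    then show ?thesis
      using enum_less_iff[OF finite_S in_S(3) in_S(3), of i j] by (simp add: in_S(1,2))
  next
    case False
    then show ?thesis
      using in_S[of i] in_S[of j] not_S[of i] not_S[of j] by (cases "i \<in> S"; cases "j \<in> S") simp_all
  qed
  then show ?thesis by (simp add: DEX_def DES_def)
qed

end

section \<open>Assembling the generating polynomial\<close>

lemma monom_sum: "monom (\<Sum>a\<in>A. f a) m = (\<Sum>a\<in>A. monom (f a) m)"
  by (induction A rule: infinite_finite_induct) (auto simp flip: add_monom)

lemma smult_sum_right: "smult c (\<Sum>a\<in>A. f a) = (\<Sum>a\<in>A. smult c (f a))"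
  by (induction A rule: infinite_finite_induct) (auto simp: smult_add_right)

text \<open>For each \<open>\<sigma>\<close>, zeros are inserted into its barred word. The factor
  \<open>t\<close> accounts for \<open>Suc\<close>, and exchanging the sums puts the support
  outermost.\<close>

lemma t_times_smult_Q:
  assumes "k \<le> n"
  shows "monom 1 1 * smult (hsym (n - k)) (Q k) =
    (\<Sum>S | S \<subseteq> {1..n} \<and> card S = k. \<Sum>\<sigma> | \<sigma> permutes {1..k}.
       monom (fund_qsym (DEX n (decorate S \<sigma>)) n) (Suc (exc n (decorate S \<sigma>))))"
proof -
  have "monom 1 1 * smult (hsym (n - k)) (Q k) =
      (\<Sum>\<sigma> | \<sigma> permutes {1..k}. monom (hsym (n - k) * fund_qsym (DEX k \<sigma>) k) (Suc (exc k \<sigma>)))"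
    by (simp add: Q_def smult_sum_right sum_distrib_left smult_monom mult_monom)
  also have "\<dots> = (\<Sum>\<sigma> | \<sigma> permutes {1..k}. \<Sum>S | S \<subseteq> {1..n} \<and> card S = k.
      monom (fund_qsym (DEX n (decorate S \<sigma>)) n) (Suc (exc n (decorate S \<sigma>))))"
  proof (rule sum.cong[OF refl], goal_cases)
    case (1 \<sigma>)
    then have \<sigma>: "\<sigma> permutes {1..k}" by simp
    \<comment> \<open>The values of \<open>\<sigma>\<close> on \<open>{1..k}\<close> are at least 1,
      so \<open>Plain 0\<close> is a new letter that can be inserted.\<close>
    then have "Plain 0 \<notin> barred k \<sigma> ` {1..k}"
    proof -
      have "barred k \<sigma> i \<noteq> Plain 0" if "i \<in> {1..k}" for i
        using permutes_in_image[OF \<sigma>, of i] that by (auto simp: barred_def)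
      then show ?thesis by force
    qed
    note hsym_times_fund_qsym[OF this assms]
    moreover have "DEX n (decorate S \<sigma>) = DES n (spread (Plain 0) S (barred k \<sigma>))"
      "exc n (decorate S \<sigma>) = exc k \<sigma>" if "S \<subseteq> {1..n} \<and> card S = k" for S
      using DEX_decorate[of S n \<sigma>] exc_decorate[of S n \<sigma>] \<sigma> that by auto
    ultimately show ?case by (simp add: DEX_def[of k] monom_sum cong: sum.cong_simp)
  qed
  also have "\<dots> = (\<Sum>S | S \<subseteq> {1..n} \<and> card S = k. \<Sum>\<sigma> | \<sigma> permutes {1..k}.
       monom (fund_qsym (DEX n (decorate S \<sigma>)) n) (Suc (exc n (decorate S \<sigma>))))"
    by (rule sum.swap)
  finally show ?thesis .
qed

text \<open>Grouping by the size of the support matches the sum in \<open>Qt\<close>: the empty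
  support yields \<open>theta\<close> and the term \<open>hsym n\<close>, and each size
  \<open>k\<close> from 1 on yields the term of \<open>Q k\<close>.\<close>

lemma Qt_conv_decorated_perms:
  "Qt n = (\<Sum>\<tau>\<in>decorated_perms n. monom (fund_qsym (dDEX n \<tau>) n) (nat (dexc n \<tau> + 1)))"
proof -
  let ?g = "\<lambda>\<tau>. monom (fund_qsym (dDEX n \<tau>) n) (nat (dexc n \<tau> + 1))"
  let ?H = "\<lambda>S. \<Sum>\<sigma> | \<sigma> permutes {1..card S}. ?g (decorate S \<sigma>)"
  have "decorate {} \<sigma> = theta" for \<sigma>
    by (simp add: fun_eq_iff decorate_def spread_def theta_def)
  \<comment> \<open>The value -1 of \<open>dexc\<close> at \<open>theta\<close> makes the exponent
    0, and the empty set has just one permutation.\<close>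
  then have H0: "?H {} = [:hsym n:]"
    by (simp add: dDEX_def dexc_def fund_qsym_empty monom_0)
  have Hk: "(\<Sum>S | S \<subseteq> {1..n} \<and> card S = k. ?H S) = monom 1 1 * smult (hsym (n - k)) (Q k)"
    if k: "k \<in> {1..n}" for k
  proof -
    \<comment> \<open>A nonempty support produces a nonzero entry, so the special values at
      \<open>theta\<close> do not interfere.\<close>
    have "decorate S \<sigma> \<noteq> theta" if S: "S \<subseteq> {1..n}" "card S = k" and \<sigma>: "\<sigma> permutes {1..k}" for S \<sigma>
    proof -
      have fin: "finite S" and "S \<noteq> {}" using S k finite_subset by auto
      then obtain i where i: "i \<in> S" by blast
      then have "\<sigma> (rank S i) \<in> {1..card S}"
        using rank_in[OF fin i] permutes_in_image[OF \<sigma>] S by auto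
      then have "decorate S \<sigma> i \<in> S" using i enum_in[OF fin] by (simp add: decorate_def spread_def)
      then have "decorate S \<sigma> i \<noteq> 0" using S by auto
      then show ?thesis by (auto simp: theta_def)
    qed
    then show ?thesis
      using k by (subst t_times_smult_Q) (auto intro!: sum.cong simp: dDEX_def dexc_def nat_add_distrib)
  qed
  have fin: "finite {S. S \<subseteq> {1..n} \<and> card S = k}" for k
    by (rule finite_subset[of _ "Pow {1..n}"]) auto
  have "{S \<in> Pow {1..n}. card S = k} = {S. S \<subseteq> {1..n} \<and> card S = k}" for k by auto
  moreover have "card ` Pow {1..n} \<subseteq> {0..n}"
    using card_mono[of "{1..n}"] by fastforce
  ultimately have "(\<Sum>S\<in>Pow {1..n}. ?H S) = (\<Sum>k=0..n. \<Sum>S | S \<subseteq> {1..n} \<and> card S = k. ?H S)"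
    using sum.group[of "Pow {1..n}" "{0..n}" card ?H] by simp
  also have "\<dots> = (\<Sum>S | S \<subseteq> {1..n} \<and> card S = 0. ?H S) +
      (\<Sum>k=1..n. \<Sum>S | S \<subseteq> {1..n} \<and> card S = k. ?H S)"
    by (simp add: sum.atLeast_Suc_atMost)
  also have "{S. S \<subseteq> {1..n} \<and> card S = 0} = {{}}"
    by (auto dest: finite_subset)
  also have "(\<Sum>S\<in>{{}}. ?H S) + (\<Sum>k=1..n. \<Sum>S | S \<subseteq> {1..n} \<and> card S = k. ?H S) = Qt n"
    using H0 Hk by (simp add: Qt_def sum_distrib_left)
  finally show ?thesis by (simp add: sum_decorated_perms)
qed

theorem theorem6p21:
  fixes n :: nat
  shows "Qt n = (\<Sum>\<sigma>\<in>decorated_perms n. monom (fund_qsym (dDEX n \<sigma>) n) (nat (dexc n \<sigma> + 1)))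
    \<and> (\<forall>j\<le>n. Qt_coeff n j =
          (\<Sum>\<sigma> | \<sigma> \<in> decorated_perms n \<and> dexc n \<sigma> = int j - 1. fund_qsym (dDEX n \<sigma>) n))"
proof (intro conjI allI impI)
  fix j
  \<comment> \<open>\<open>dexc\<close> is at least -1, so \<open>nat\<close> truncates
    nothing.\<close>
  have eq: "nat (dexc n \<sigma> + 1) = j \<longleftrightarrow> dexc n \<sigma> = int j - 1" for \<sigma>
    by (auto simp: dexc_def)
  have "Qt_coeff n j = (\<Sum>\<sigma>\<in>decorated_perms n.
      if dexc n \<sigma> = int j - 1 then fund_qsym (dDEX n \<sigma>) n else 0)"
    by (simp add: Qt_coeff_def Qt_conv_decorated_perms coeff_sum eq)
  also have "\<dots> = (\<Sum>\<sigma> | \<sigma> \<in> decorated_perms n \<and> dexc n \<sigma> = int j - 1. fund_qsym (dDEX n \<sigma>) n)"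
    by (simp add: sum.If_cases[OF finite_decorated_perms] Int_def conj_commute)
  finally show "Qt_coeff n j = \<dots>" .
qed (rule Qt_conv_decorated_perms)

end
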